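(* Let $m$ and $n$ be positive integers. For a non-negative integer $k$ define the polynomials $$d_k(x)=\sum_{i=0}^k\binom{k}{i}\binom{x}{i}2^i,\qquad s_k(x)=\sum_{i=0}^k\binom{k}{i}\binom{x}{i}\binom{x+i}{i}.$$ Then each of the polynomials \begin{align*} &\frac{x(x+1)}{2n^2}\sum_{k=0}^{n-1}(2k+1)d_k(x)^2,\quad \frac{1}{n}\sum_{k=0}^{n-1}(2k+1)d_k(x)^{2m},\quad \frac{1}{n}\sum_{k=0}^{n-1}(-1)^k(2k+1)d_k(x)^{2m}, \\ &\frac{1}{n^2}\sum_{k=0}^{n-1}(2k+1)s_k(x)^2,\quad \frac{1}{n}\sum_{k=0}^{n-1}(2k+1)s_k(x)^{2m},\quad \frac{1}{n}\sum_{k=0}^{n-1}(-1)^k(2k+1)s_k(x)^{2m} \end{align*} is integer-valued.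
   Context: Here $\binom{x}{i}=x(x-1)\cdots(x-i+1)/i!$ is a polynomial in $x$. A polynomial $P(x)$ with real coefficients is called integer-valued if $P(x)\in\mathbb{Z}$ for all $x\in\mathbb{Z}$. *)

theory Defs
  imports Complex_Main "HOL-Computational_Algebra.Polynomial"
begin

definition integer_valued :: "real poly \<Rightarrow> bool" where
  "integer_valued P \<longleftrightarrow> (\<forall>x::int. poly P (of_int x) \<in> \<int>)"

text \<open>
  The polynomial \<open>p (p - 1) \<cdots> (p - i + 1) / i!\<close>. The indeterminate \<open>x\<close> is \<open>[:0, 1:]\<close>, so
  \<open>binom_poly [:0, 1:] i\<close> is the binomial polynomial \<open>x\<close> over \<open>i\<close>. The sort constraint
  imposed on \<open>gchoose\<close> rules out \<open>real poly\<close>; the lemma \<open>poly_binom_poly\<close> gives the link.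
\<close>

definition binom_poly :: "real poly \<Rightarrow> nat \<Rightarrow> real poly" where
  "binom_poly p i = smult (1 / fact i) (\<Prod>j=0..<i. p - of_nat j)"

lemma poly_binom_poly: "poly (binom_poly p i) x = poly p x gchoose i"
  by (simp add: binom_poly_def gbinomial_prod_rev poly_prod)

definition d_poly :: "nat \<Rightarrow> real poly" where
  "d_poly k = (\<Sum>i=0..k. of_nat (k choose i) * binom_poly [:0, 1:] i * 2 ^ i)"

definition s_poly :: "nat \<Rightarrow> real poly" where
  "s_poly k = (\<Sum>i=0..k. of_nat (k choose i) * binom_poly [:0, 1:] i
                 * binom_poly ([:0, 1:] + of_nat i) i)"

end

theory Submission
  imports Defs
begin

text \<open>
  Write \<open>B(x, j)\<close> for the product of \<open>x\<close> over \<open>j\<close> and \<open>x + j\<close> over \<open>j\<close>; up to a scalar it is the product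
  of \<open>x (x + 1) - t (t + 1)\<close> over \<open>t < j\<close>. Then, with \<open>C\<close> denoting binomial coefficients,
  \<open>d_k(x)\<^sup>2\<close> is the sum of \<open>4^j C(x + j, 2 j) B(k, j)\<close> over \<open>j\<close>, and
  \<open>s_k(x)\<^sup>2\<close> is the sum of \<open>C(2 j, r) C(r, j) B(k, j) B(x, r)\<close> over \<open>j\<close> and \<open>r\<close>.
  Both follow from three-term recurrences, in \<open>k\<close> for \<open>d\<close> and in \<open>x\<close> for \<open>s\<close>.
  The integer span of the functions \<open>B(\<cdot>, j)\<close> is closed under products, so it contains all even powers
  of \<open>k \<mapsto> d_k(x)\<close> and \<open>k \<mapsto> s_k(x)\<close>; and the sums of \<open>(2 k + 1) B(k, j)\<close> and
  \<open>(-1)^k (2 k + 1) B(k, j)\<close> over \<open>k < n\<close> have closed forms divisible by \<open>n\<close>. The former is even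
  divisible by \<open>n\<^sup>2\<close> after multiplication by \<open>j + 1\<close>, a factor which is present in \<open>C(2 j, r) C(r, j)\<close>
  and in \<open>x (x + 1) C(x + j, 2 j)\<close>.
\<close>

section \<open>Products of binomial polynomials\<close>

definition central_binom :: "real \<Rightarrow> nat \<Rightarrow> real" where
  "central_binom x j = (x + real j) gchoose (2 * j)"

text \<open>This is B(x, j). The argument is real so that shifts and reflection stay polynomial
  identities in \<open>x\<close>, also at arguments such as \<open>real k - 1\<close> with k =
  0.\<close>

definition binom_pair :: "real \<Rightarrow> nat \<Rightarrow> real" where
  "binom_pair x j = (x gchoose j) * ((x + real j) gchoose j)"

lemma binom_pair_0 [simp]: "binom_pair x 0 = 1"
  by (simp add: binom_pair_def)

lemma central_binom_0 [simp]: "central_binom x 0 = 1"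
  by (simp add: central_binom_def)

lemma gchoose_Suc_mult: "(real k + 1) * (a gchoose Suc k) = (a - real k) * (a gchoose k)" for a :: real
  using gbinomial_mult_1[of a k] by (simp add: algebra_simps)

lemma gchoose_Suc_Suc_mult: "(real k + 1) * (a + 1 gchoose Suc k) = (a + 1) * (a gchoose k)" for a :: real
  using Suc_times_gbinomial[of k a] by (simp add: algebra_simps)

lemma binom_pair_Suc:
  "(real j + 1)\<^sup>2 * binom_pair x (Suc j) = (x - real j) * (x + real j + 1) * binom_pair x j"
proof -
  have "binom_pair x (Suc j) = (x gchoose Suc j) * (x + real j + 1 gchoose Suc j)"
    by (simp add: binom_pair_def add_ac)
  then show ?thesis
    unfolding binom_pair_def using gchoose_Suc_Suc_mult[of j "x + real j"] gchoose_Suc_mult[of j x]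
    by algebra
qed

text \<open>The step from C(x + j, 2 j) to C(x + j + 1, 2 j + 2) is absorption of the top factor x +
  j + 1 followed by one increase of the lower index.\<close>

lemma central_binom_Suc:
  "(2 * real j + 1) * (2 * real j + 2) * central_binom x (Suc j)
     = (x - real j) * (x + real j + 1) * central_binom x j"
proof -
  have "(2 * real j + 2) * (x + real j + 1 gchoose Suc (Suc (2 * j)))
      = (x + real j + 1) * (x + real j gchoose Suc (2 * j))"
    using gchoose_Suc_Suc_mult[of "Suc (2 * j)" "x + real j"] by (simp add: add_ac)
  moreover have "(2 * real j + 1) * (x + real j gchoose Suc (2 * j)) = (x - real j) * (x + real j gchoose (2 * j))"
    using gchoose_Suc_mult[of "2 * j" "x + real j"] by simp
  moreover have "central_binom x (Suc j) = (x + real j + 1 gchoose Suc (Suc (2 * j)))"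
    by (simp add: central_binom_def add_ac)
  ultimately show ?thesis
    unfolding central_binom_def by algebra
qed

lemma cancel_left: "c * a = c * b \<Longrightarrow> c \<noteq> 0 \<Longrightarrow> a = b" for a b c :: real
  by simp

text \<open>By \<open>binom_pair_Suc\<close> and \<open>central_binom_Suc\<close> the two sides
  satisfy the same first-order recurrence in \<open>j\<close>, once the ratio of consecutive central
  binomial coefficients is inserted.\<close>

lemma binom_pair_eq_central_binom: "binom_pair x j = real (2 * j choose j) * central_binom x j"
proof (induction j)
  case (Suc j)
  have "real (2 * j choose j) = fact (2 * j) / (fact j)\<^sup>2"
    by (simp add: binomial_fact power2_eq_square)
  moreover have "real (2 * Suc j choose Suc j)
      = (2 * real j + 2) * ((2 * real j + 1) * fact (2 * j)) / ((real j + 1) * fact j)\<^sup>2"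
    by (simp add: binomial_fact power2_eq_square add_ac del: binomial_Suc_Suc)
  ultimately have *: "(real j + 1)\<^sup>2 * real (2 * Suc j choose Suc j)
     = (2 * real j + 1) * (2 * real j + 2) * real (2 * j choose j)"
    by (simp add: power_mult_distrib mult_ac del: binomial_Suc_Suc)
  show ?case
    by (rule cancel_left[where c = "(real j + 1)\<^sup>2"],
        use * binom_pair_Suc[of j x] central_binom_Suc[of j x] Suc in algebra) simp
qed simp

text \<open>The factor (x - j)(x + j + 1) = x(x + 1) - j(j + 1) gained at each step is invariant
  under x -> -1 - x.\<close>

lemma binom_pair_reflect: "binom_pair (- 1 - x) j = binom_pair x j"
proof (induction j)
  case (Suc j)
  show ?case
    by (rule cancel_left[where c = "(real j + 1)\<^sup>2"], unfold binom_pair_Suc Suc, algebra) simp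
qed simp

lemma binom_pair_of_nat: "binom_pair (real n) j = real ((n choose j) * (n + j choose j))"
  using binomial_gbinomial[of "n + j" j, where 'a = real]
  by (simp add: binom_pair_def binomial_gbinomial)

lemma binom_pair_of_nat_eq_0: "n < j \<Longrightarrow> binom_pair (real n) j = 0"
  by (simp add: binom_pair_of_nat)

text \<open>Together with the symmetry x -> -1 - x this reduces statements about integers to natural
  numbers.\<close>

lemma int_cases_reflect:
  obtains n where "x = int n" | n where "x = - 1 - int n"
proof (cases "0 \<le> x")
  case True
  then show thesis using that(1)[of "nat x"] by simp
next
  case False
  then show thesis using that(2)[of "nat (- 1 - x)"] by simp
qed

lemma central_binom_Ints: "central_binom (real_of_int x) j \<in> \<int>"
proof (cases x rule: int_cases_reflect)
  case (1 n)
  then show ?thesis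
    by (simp add: central_binom_def flip: of_nat_add binomial_gbinomial)
next
  case (2 n)
  have "central_binom (- 1 - real n) j = central_binom (real n) j"
    using binom_pair_reflect[of "real n" j] by (simp add: binom_pair_eq_central_binom)
  then show ?thesis
    using 2 by (simp add: central_binom_def flip: of_nat_add binomial_gbinomial)
qed

lemma binom_pair_Ints: "binom_pair (real_of_int x) j \<in> \<int>"
  by (simp add: binom_pair_eq_central_binom central_binom_Ints Ints_mult)

section \<open>Shifts and weighted differences in the argument\<close>

text \<open>Up to the factor (r!)^2, B(x, r) is the product of the 2 r consecutive factors from x -
  r + 1 to x + r. Passing to B(x + 1, r + 1) appends x + r + 1 and x + r + 2.\<close>

lemma binom_pair_shift_up:
  "(real r + 1)\<^sup>2 * binom_pair (x + 1) (Suc r) = (x + real r + 2) * (x + real r + 1) * binom_pair x r"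
proof (induction r)
  case 0
  show ?case using binom_pair_Suc[of 0 "x + 1"] by simp
next
  case (Suc r)
  have "(real r + 2)\<^sup>2 * binom_pair (x + 1) (Suc (Suc r)) = (x - real r) * (x + real r + 3) * binom_pair (x + 1) (Suc r)"
    using binom_pair_Suc[of "Suc r" "x + 1"] by (simp add: add_ac)
  then have "(real r + 1)\<^sup>2 * ((real r + 2)\<^sup>2 * binom_pair (x + 1) (Suc (Suc r)))
      = (x - real r) * (x + real r + 3) * ((real r + 1)\<^sup>2 * binom_pair (x + 1) (Suc r))"
    by (simp only: mult_ac)
  also have "\<dots> = (x + real r + 3) * (x + real r + 2) * ((real r + 1)\<^sup>2 * binom_pair x (Suc r))"
    unfolding Suc binom_pair_Suc[of r x] by (simp only: mult_ac)
  also have "\<dots> = (real r + 1)\<^sup>2 * ((x + real r + 3) * (x + real r + 2) * binom_pair x (Suc r))"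
    by (simp only: mult_ac)
  finally have "(real r + 2)\<^sup>2 * binom_pair (x + 1) (Suc (Suc r))
      = (x + real r + 3) * (x + real r + 2) * binom_pair x (Suc r)"
    by (rule cancel_left) simp
  then show ?case by (simp add: add_ac)
qed

lemma binom_pair_shift_down:
  "(real r + 1)\<^sup>2 * binom_pair (x - 1) (Suc r) = (x - real r - 1) * (x - real r) * binom_pair x r"
proof -
  have "binom_pair (x - 1) (Suc r) = binom_pair (- 1 - x + 1) (Suc r)"
    using binom_pair_reflect[of "x - 1" "Suc r"] by simp
  then have "(real r + 1)\<^sup>2 * binom_pair (x - 1) (Suc r)
      = (- 1 - x + real r + 2) * (- 1 - x + real r + 1) * binom_pair x r"
    by (simp only: binom_pair_shift_up binom_pair_reflect)
  also have "\<dots> = (x - real r - 1) * (x - real r) * binom_pair x r"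
    by algebra
  finally show ?thesis .
qed

text \<open>This operator in \<open>x\<close> underlies the recurrences for d_k(x)^2 (with argument
  k) and for s_k(x) (with argument x). All shifted values are polynomial multiples of one quantity
  \<open>b\<close>, so a polynomial identity remains; at r = 0 the factor \<open>real r\<close>
  removes the truncated index.\<close>

lemma binom_pair_difference2:
  "(x + 1)\<^sup>2 * binom_pair (x + 1) r - x\<^sup>2 * binom_pair (x - 1) r
     = (2 * x + 1) * ((2 * real r + 1) * binom_pair x r + 2 * real r * binom_pair x (r - 1))"
proof (cases r)
  case (Suc q)
  define c where "c = (real q + 1)\<^sup>2"
  define b where "b = binom_pair x q / c"
  have c: "c \<noteq> 0" by (simp add: c_def)
  have eqs: "binom_pair x q = c * b"
    "binom_pair x (Suc q) = (x - real q) * (x + real q + 1) * b"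
    "binom_pair (x + 1) (Suc q) = (x + real q + 2) * (x + real q + 1) * b"
    "binom_pair (x - 1) (Suc q) = (x - real q - 1) * (x - real q) * b"
    using c binom_pair_Suc[of q x] binom_pair_shift_up[of q x] binom_pair_shift_down[of q x]
    by (simp_all add: b_def nonzero_eq_divide_eq mult.commute flip: c_def)
  show ?thesis
    by (simp add: Suc eqs c_def) algebra
qed (simp add: power2_eq_square algebra_simps)

text \<open>The analogue with fourth powers, as required for s_k(x)^2: the recurrence for s in
  \<open>x\<close> has leading coefficient (x + 1)^2, which gets squared.\<close>

lemma binom_pair_difference4:
  "(x + 1) ^ 4 * binom_pair (x + 1) r - x ^ 4 * binom_pair (x - 1) r
     = (2 * x + 1) * (2 * ((real r + 1) ^ 3 * binom_pair x (Suc r))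
         + (2 * real r + 1) * (2 * (real r)\<^sup>2 + 2 * real r + 1) * binom_pair x r
         + 2 * real r ^ 3 * binom_pair x (r - 1))"
proof (cases r)
  case 0
  have "binom_pair x (Suc 0) = x * (x + 1)"
    using binom_pair_Suc[of 0 x] by simp
  moreover have "(x + 1) ^ 4 - x ^ 4 = (2 * x + 1) * (2 * (x * (x + 1)) + 1)"
    by algebra
  ultimately show ?thesis
    by (simp add: 0)
next
  case (Suc q)
  define c where "c = (real q + 1)\<^sup>2"
  define b where "b = binom_pair x q / c"
  have c: "c \<noteq> 0" by (simp add: c_def)
  have eqs: "binom_pair x q = c * b"
    "binom_pair x (Suc q) = (x - real q) * (x + real q + 1) * b"
    "binom_pair (x + 1) (Suc q) = (x + real q + 2) * (x + real q + 1) * b"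
    "binom_pair (x - 1) (Suc q) = (x - real q - 1) * (x - real q) * b"
    using c binom_pair_Suc[of q x] binom_pair_shift_up[of q x] binom_pair_shift_down[of q x]
    by (simp_all add: b_def nonzero_eq_divide_eq mult.commute flip: c_def)
  have "(real q + 2)\<^sup>2 * binom_pair x (Suc r) = (x - real q - 1) * (x + real q + 2) * binom_pair x (Suc q)"
    using binom_pair_Suc[of "Suc q" x] by (simp add: Suc algebra_simps)
  then have eq3: "(real r + 1) ^ 3 * binom_pair x (Suc r)
      = (real q + 2) * ((x - real q - 1) * (x + real q + 2) * binom_pair x (Suc q))"
    by (simp add: Suc power2_eq_square power3_eq_cube add_ac mult_ac)
  show ?thesis
    unfolding eq3 by (simp add: Suc eqs c_def) algebra
qed

section \<open>The span of the products\<close>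

text \<open>Comparing \<open>binom_pair_shift_up\<close> with \<open>binom_pair_Suc\<close> gives a
  first-order recurrence in \<open>x\<close>. It is the telescoping step in the three sums that
  follow.\<close>

lemma binom_pair_step: "(x + 1 - real j) * binom_pair (x + 1) j = (x + 1 + real j) * binom_pair x j"
proof (cases j)
  case (Suc r)
  have "(real r + 1)\<^sup>2 * ((x - real r) * binom_pair (x + 1) (Suc r))
      = (x - real r) * ((real r + 1)\<^sup>2 * binom_pair (x + 1) (Suc r))"
    by (simp only: mult_ac)
  also have "\<dots> = (x + real r + 2) * ((real r + 1)\<^sup>2 * binom_pair x (Suc r))"
    unfolding binom_pair_shift_up binom_pair_Suc[of r x] by (simp only: mult_ac)
  also have "\<dots> = (real r + 1)\<^sup>2 * ((x + real r + 2) * binom_pair x (Suc r))"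
    by (simp only: mult_ac)
  finally have "(x - real r) * binom_pair (x + 1) (Suc r) = (x + real r + 2) * binom_pair x (Suc r)"
    by (rule cancel_left) simp
  then show ?thesis
    by (simp add: Suc add_ac)
qed simp

lemma sum_binom_pair:
  "(2 * real j + 1) * (\<Sum>k<n. binom_pair (real k) j) = (real n - real j) * binom_pair (real n) j"
proof (induction n)
  case 0
  show ?case by (cases j) (simp_all add: binom_pair_of_nat_eq_0[of 0, simplified])
next
  case (Suc n)
  have "(real n + 1 - real j) * binom_pair (real n + 1) j - (real n - real j) * binom_pair (real n) j
      = (2 * real j + 1) * binom_pair (real n) j"
    unfolding binom_pair_step by algebra
  with Suc show ?case by (simp add: distrib_left add_ac)
qed

lemma sum_odd_binom_pair:
  "(real j + 1) * (\<Sum>k<n. (2 * real k + 1) * binom_pair (real k) j)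
     = real n * ((real n - real j) * binom_pair (real n) j)"
proof (induction n)
  case (Suc n)
  have "(real n + 1) * ((real n + 1 - real j) * binom_pair (real n + 1) j)
      - real n * ((real n - real j) * binom_pair (real n) j)
      = (real j + 1) * ((2 * real n + 1) * binom_pair (real n) j)"
    unfolding binom_pair_step by algebra
  with Suc show ?case by (simp add: distrib_left[of "1 + real j"] add_ac)
qed simp

lemma sum_alternating_odd_binom_pair:
  "(\<Sum>k<n. (- 1) ^ k * (2 * real k + 1) * binom_pair (real k) j)
     = - ((- 1) ^ n * ((real n - real j) * binom_pair (real n) j))"
proof (induction n)
  case 0
  show ?case by (cases j) (simp_all add: binom_pair_of_nat_eq_0[of 0, simplified])
next
  case (Suc n)
  have "(real n + 1 - real j) * binom_pair (real n + 1) j + (real n - real j) * binom_pair (real n) j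
      = (2 * real n + 1) * binom_pair (real n) j"
    unfolding binom_pair_step by algebra
  from arg_cong[OF this, of "\<lambda>t. (- 1) ^ n * t"] Suc show ?case
    by (simp add: distrib_left[where a = "(- 1) ^ n"] mult.assoc add_ac)
qed

text \<open>Absorption, (n - j) C(n, j) = n C(n - 1, j), exposes a factor n in the closed forms of
  the odd-weighted sums.\<close>

lemma diff_mult_binom_pair:
  "(real n - real j) * binom_pair (real n) j = real n * real ((n - 1 choose j) * (n + j choose j))"
proof (cases "j \<le> n")
  case True
  then have "(real n - real j) * real (n choose j) = real n * real (n - 1 choose j)"
    using arg_cong[OF binomial_absorb_comp[of n j], of real] by (simp add: of_nat_diff)
  then show ?thesis by (simp add: binom_pair_of_nat mult.assoc[symmetric])
qed (simp add: binom_pair_of_nat binomial_eq_0)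

lemma mult_choose_pred: "real n * real (n - 1 choose j) = (real j + 1) * real (n choose Suc j)"
proof (cases n)
  case (Suc m)
  then show ?thesis
    using arg_cong[OF Suc_times_binomial_eq[of m j], of real] by (simp add: algebra_simps del: binomial_Suc_Suc)
qed simp

text \<open>
  Extending \<open>1 / k!\<close> by zero to negative integers makes \<open>inv_fact_pred\<close> and \<open>choose_eq_inv_fact\<close>
  unconditional, so that binomial identities reduce to polynomial ones without boundary cases.
\<close>

definition inv_fact :: "int \<Rightarrow> real" where
  "inv_fact k = (if k < 0 then 0 else 1 / fact (nat k))"

lemma inv_fact_pred: "inv_fact (k - 1) = of_int k * inv_fact k"
proof (cases "0 < k")
  case True
  then have "nat k = Suc (nat (k - 1))" by simp
  then show ?thesis using True by (simp add: inv_fact_def)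
qed (auto simp: inv_fact_def)

lemma fact_mult_inv_fact [simp]: "fact n * inv_fact (int n) = 1"
  by (simp add: inv_fact_def)

lemma choose_eq_inv_fact: "real (n choose k) = fact n * inv_fact (int k) * inv_fact (int n - int k)"
proof (cases "k \<le> n")
  case True
  then show ?thesis by (simp add: binomial_fact inv_fact_def nat_diff_distrib)
qed (simp add: inv_fact_def)

section \<open>Linearization of products\<close>

text \<open>Increasing \<open>i\<close> multiplies B(x, i) by (x - i)(x + i + 1), up to (i + 1)^2.
  Written as (x - r)(x + r + 1) + r(r + 1) - i(i + 1), this factor sends B(x, r) to a multiple of
  B(x, r + 1) plus a multiple of itself; the identity compares the coefficients.\<close>

lemma product_coeff_Suc:
  "(real i + 1)\<^sup>2 * real ((r choose Suc i) * (r choose j) * (Suc i + j choose r))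
     = (real r)\<^sup>2 * real ((r - 1 choose i) * (r - 1 choose j) * (i + j choose (r - 1)))
       + (real r * (real r + 1) - real i * (real i + 1)) * real ((r choose i) * (r choose j) * (i + j choose r))"
proof (cases r)
  case 0
  then show ?thesis by (cases i) simp_all
next
  case (Suc q)
  define F :: real where "F = fact (i + j)"
  define G :: real where "G = fact q"
  \<comment> \<open>Each reciprocal factorial is taken at the largest argument that occurs, since
    \<open>inv_fact_pred\<close> expresses smaller arguments through larger ones without
    division.\<close>
  define \<alpha> where "\<alpha> = inv_fact (int i + 1)"
  define \<beta> where "\<beta> = inv_fact (int j)"
  define \<gamma> where "\<gamma> = inv_fact (int q + 1 - int i)"
  define \<delta> where "\<delta> = inv_fact (int q + 1 - int j)"
  define \<epsilon> where "\<epsilon> = inv_fact (int i + int j - int q)"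
  define \<eta> where "\<eta> = inv_fact (int q + 1)"
  have "inv_fact (int i) = (real i + 1) * \<alpha>" "inv_fact (int q) = (real q + 1) * \<eta>"
    "inv_fact (int q - int i) = (real q + 1 - real i) * \<gamma>"
    "inv_fact (int q - int j) = (real q + 1 - real j) * \<delta>"
    "inv_fact (int i + int j - int q - 1) = (real i + real j - real q) * \<epsilon>"
    using inv_fact_pred[of "int i + 1"] inv_fact_pred[of "int q + 1"] inv_fact_pred[of "int q + 1 - int i"]
      inv_fact_pred[of "int q + 1 - int j"] inv_fact_pred[of "int i + int j - int q"]
    by (simp_all add: \<alpha>_def \<gamma>_def \<delta>_def \<epsilon>_def \<eta>_def)
  then have eqs:
    "real (Suc q choose Suc i) = (real q + 1) * G * \<alpha> * ((real q + 1 - real i) * \<gamma>)"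
    "real (Suc q choose j) = (real q + 1) * G * \<beta> * \<delta>"
    "real (Suc (i + j) choose Suc q) = (real i + real j + 1) * F * \<eta> * \<epsilon>"
    "real (q choose i) = G * ((real i + 1) * \<alpha>) * ((real q + 1 - real i) * \<gamma>)"
    "real (q choose j) = G * \<beta> * ((real q + 1 - real j) * \<delta>)"
    "real (i + j choose q) = F * ((real q + 1) * \<eta>) * \<epsilon>"
    "real (Suc q choose i) = (real q + 1) * G * ((real i + 1) * \<alpha>) * \<gamma>"
    "real (i + j choose Suc q) = F * \<eta> * ((real i + real j - real q) * \<epsilon>)"
    by (simp_all add: choose_eq_inv_fact F_def G_def \<alpha>_def \<beta>_def \<gamma>_def \<delta>_def \<epsilon>_def \<eta>_def add_ac diff_diff_eq
          del: binomial_Suc_Suc)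
  show ?thesis
    unfolding Suc diff_Suc_1 add_Suc of_nat_mult eqs of_nat_Suc by algebra
qed

lemma binom_pair_mult:
  assumes "i + j < M"
  shows "binom_pair x i * binom_pair x j
     = (\<Sum>r<M. real ((r choose i) * (r choose j) * (i + j choose r)) * binom_pair x r)"
  using assms
proof (induction i)
  case 0
  have "(\<Sum>r<M. real ((r choose 0) * (r choose j) * (0 + j choose r)) * binom_pair x r)
      = (\<Sum>r<M. if r = j then binom_pair x r else 0)"
    by (intro sum.cong refl) (metis (no_types, lifting) add_0 binomial_eq_0 binomial_n_0 binomial_n_n linorder_neqE_nat mult_1
          mult_zero_left mult_zero_right of_nat_0 of_nat_1)
  then show ?case using 0 by simp
next
  case (Suc i)
  define p where "p r = real ((r choose i) * (r choose j) * (i + j choose r))" for r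
  define p' where "p' r = real ((r choose Suc i) * (r choose j) * (Suc i + j choose r))" for r
  \<comment> \<open>\<open>H (Suc r)\<close> is the contribution of index r that is raised to B(x, r
    + 1); summing over r only reindexes it.\<close>
  define H where "H r = (real r)\<^sup>2 * p (r - 1) * binom_pair x r" for r
  have step: "(x - real i) * (x + real i + 1) * (p r * binom_pair x r) - (real i + 1)\<^sup>2 * (p' r * binom_pair x r)
      = H (Suc r) - H r" for r
  proof -
    have "H (Suc r) = p r * ((x - real r) * (x + real r + 1) * binom_pair x r)"
      unfolding binom_pair_Suc[symmetric] by (simp add: H_def add_ac mult_ac)
    moreover have "(real i + 1)\<^sup>2 * (p' r * binom_pair x r)
        = ((real r)\<^sup>2 * p (r - 1) + (real r * (real r + 1) - real i * (real i + 1)) * p r) * binom_pair x r"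
      using product_coeff_Suc[of i r j] unfolding p_def p'_def by (metis mult.assoc)
    ultimately show ?thesis
      unfolding H_def by algebra
  qed
  have "(x - real i) * (x + real i + 1) * (\<Sum>r<M. p r * binom_pair x r)
      - (real i + 1)\<^sup>2 * (\<Sum>r<M. p' r * binom_pair x r) = (\<Sum>r<M. H (Suc r) - H r)"
    by (simp only: sum_distrib_left step flip: sum_subtractf)
  also have "\<dots> = H M - H 0"
    by (rule sum_lessThan_telescope)
  \<comment> \<open>\<open>H 0\<close> vanishes through the factor r^2, and \<open>H M\<close>
    because i + j < M - 1 makes C(i + j, M - 1) zero.\<close>
  also have "\<dots> = 0"
    using Suc.prems by (simp add: H_def p_def binomial_eq_0)
  finally have *: "(real i + 1)\<^sup>2 * (\<Sum>r<M. p' r * binom_pair x r)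
      = (x - real i) * (x + real i + 1) * (\<Sum>r<M. p r * binom_pair x r)" by simp
  have "(\<Sum>r<M. p r * binom_pair x r) = binom_pair x i * binom_pair x j"
    using Suc unfolding p_def by simp
  then have "(real i + 1)\<^sup>2 * (binom_pair x (Suc i) * binom_pair x j)
      = (real i + 1)\<^sup>2 * (\<Sum>r<M. p' r * binom_pair x r)"
    using binom_pair_Suc[of i x] * by (metis mult.assoc)
  then have "binom_pair x (Suc i) * binom_pair x j = (\<Sum>r<M. p' r * binom_pair x r)"
    by (rule cancel_left) simp
  then show ?case unfolding p'_def .
qed

section \<open>The integer span and its closure properties\<close>

text \<open>The additive group generated by the functions B(., j). Rule induction reduces closure
  under products and divisibility of sums to the generators; integer multiples are derived.\<close>

inductive_set binom_span :: "(nat \<Rightarrow> real) set" where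
  gen: "(\<lambda>k. binom_pair (real k) j) \<in> binom_span"
| add: "f \<in> binom_span \<Longrightarrow> g \<in> binom_span \<Longrightarrow> (\<lambda>k. f k + g k) \<in> binom_span"
| uminus: "f \<in> binom_span \<Longrightarrow> (\<lambda>k. - f k) \<in> binom_span"

lemma binom_span_0: "(\<lambda>k. 0) \<in> binom_span"
  using binom_span.add[OF binom_span.gen[of 0] binom_span.uminus[OF binom_span.gen[of 0]]] by simp

lemma binom_span_1: "(\<lambda>k. 1) \<in> binom_span"
  using binom_span.gen[of 0] by simp

lemma binom_span_of_nat: "f \<in> binom_span \<Longrightarrow> (\<lambda>k. real m * f k) \<in> binom_span"
  by (induction m) (simp_all add: binom_span_0 distrib_right binom_span.add)

lemma binom_span_Ints:
  assumes "f \<in> binom_span" "c \<in> \<int>"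
  shows "(\<lambda>k. c * f k) \<in> binom_span"
proof -
  obtain z where z: "c = of_int z" using assms(2) by (auto elim: Ints_cases)
  show ?thesis
  proof (cases "0 \<le> z")
    case True
    then show ?thesis using binom_span_of_nat[OF assms(1), of "nat z"] z by simp
  next
    case False
    then show ?thesis using binom_span.uminus[OF binom_span_of_nat[OF assms(1), of "nat (- z)"]] z by simp
  qed
qed

lemma binom_span_sum: "(\<And>i. i \<in> A \<Longrightarrow> f i \<in> binom_span) \<Longrightarrow> (\<lambda>k. \<Sum>i\<in>A. f i k) \<in> binom_span"
  by (induction A rule: infinite_finite_induct) (simp_all add: binom_span_0 binom_span.add)

lemma binom_span_mult:
  assumes "f \<in> binom_span" "g \<in> binom_span"
  shows "(\<lambda>k. f k * g k) \<in> binom_span"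
  using assms(1)
proof induction
  case (gen i)
  from assms(2) show ?case
  proof induction
    case (gen j)
    have "(\<lambda>k. \<Sum>r<Suc (i + j). real ((r choose i) * (r choose j) * (i + j choose r)) * binom_pair (real k) r)
        \<in> binom_span"
      by (intro binom_span_sum binom_span_of_nat binom_span.gen)
    then show ?case by (simp only: binom_pair_mult[of i j "Suc (i + j)"] lessI)
  next
    case (add f g)
    then show ?case by (simp add: distrib_left binom_span.add)
  next
    case (uminus f)
    then show ?case using binom_span.uminus by fastforce
  qed
next
  case (add f h)
  then show ?case by (simp add: distrib_right binom_span.add)
next
  case (uminus f)
  then show ?case using binom_span.uminus by fastforce
qed

lemma binom_span_power: "f \<in> binom_span \<Longrightarrow> (\<lambda>k. f k ^ m) \<in> binom_span"
  by (induction m) (simp_all add: binom_span_1 binom_span_mult)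

section \<open>Divisibility of the sums by n and n^2\<close>

text \<open>For a generator, j + 1 times the sum equals n^2 C(n - 1, j) C(n + j, j). Rewriting n C(n
  - 1, j) as (j + 1) C(n, j + 1) allows j + 1 to be cancelled, at the cost of one factor n.\<close>

lemma sum_odd_binom_span:
  assumes "f \<in> binom_span"
  shows "\<exists>z\<in>\<int>. (\<Sum>k<n. (2 * real k + 1) * f k) = real n * z"
  using assms
proof induction
  case (gen j)
  have "(real j + 1) * (\<Sum>k<n. (2 * real k + 1) * binom_pair (real k) j)
      = (real j + 1) * (real n * real ((n choose Suc j) * (n + j choose j)))"
    unfolding sum_odd_binom_pair diff_mult_binom_pair using mult_choose_pred[of n j]
    by (metis (no_types, lifting) mult.assoc mult.left_commute of_nat_mult)
  then have "(\<Sum>k<n. (2 * real k + 1) * binom_pair (real k) j) = real n * real ((n choose Suc j) * (n + j choose j))"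
    by (rule cancel_left) simp
  then show ?case by (metis Ints_of_nat)
next
  case (add f g)
  then show ?case by (auto simp: distrib_left sum.distrib) (metis Ints_add distrib_left)
next
  case (uminus f)
  then show ?case by (auto simp: sum_negf) (metis Ints_minus mult_minus_right)
qed

lemma sum_alternating_odd_binom_span:
  assumes "f \<in> binom_span"
  shows "\<exists>z\<in>\<int>. (\<Sum>k<n. (- 1) ^ k * (2 * real k + 1) * f k) = real n * z"
  using assms
proof induction
  case (gen j)
  have "(\<Sum>k<n. (- 1) ^ k * (2 * real k + 1) * binom_pair (real k) j)
      = real n * - ((- 1) ^ n * real ((n - 1 choose j) * (n + j choose j)))"
    unfolding sum_alternating_odd_binom_pair diff_mult_binom_pair by simp
  moreover have "- ((- 1) ^ n * real ((n - 1 choose j) * (n + j choose j))) \<in> \<int>"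
    by (intro Ints_minus Ints_mult Ints_power Ints_of_nat) simp_all
  ultimately show ?case by blast
next
  case (add f g)
  then show ?case by (auto simp: distrib_left sum.distrib) (metis Ints_add distrib_left)
next
  case (uminus f)
  then show ?case by (auto simp: sum_negf) (metis Ints_minus mult_minus_right)
qed

text \<open>The weight j + 1 in the coefficients absorbs the one in
  \<open>sum_odd_binom_pair\<close>, so both factors n survive.\<close>

lemma sum_odd_binom_pair_combination:
  assumes "\<And>k. k < n \<Longrightarrow> f k = (\<Sum>j<n. (real j + 1) * e j * binom_pair (real k) j)"
  shows "(\<Sum>k<n. (2 * real k + 1) * f k)
     = (real n)\<^sup>2 * (\<Sum>j<n. e j * real ((n - 1 choose j) * (n + j choose j)))"
proof -
  have "(\<Sum>k<n. (2 * real k + 1) * f k)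
      = (\<Sum>k<n. \<Sum>j<n. e j * ((real j + 1) * ((2 * real k + 1) * binom_pair (real k) j)))"
    by (intro sum.cong refl) (simp add: assms sum_distrib_left mult_ac)
  also have "\<dots> = (\<Sum>j<n. e j * ((real j + 1) * (\<Sum>k<n. (2 * real k + 1) * binom_pair (real k) j)))"
    by (subst sum.swap) (simp only: sum_distrib_left)
  also have "\<dots> = (real n)\<^sup>2 * (\<Sum>j<n. e j * real ((n - 1 choose j) * (n + j choose j)))"
    unfolding sum_odd_binom_pair diff_mult_binom_pair
    by (simp add: sum_distrib_left power2_eq_square mult_ac)
  finally show ?thesis .
qed

section \<open>Squares of solutions of three-term recurrences\<close>

text \<open>
  The recurrence for \<open>y\<close> telescopes \<open>c k * y (k - 1) * y k\<close>, which turns its square into a recurrence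
  that involves only squares.
\<close>

lemma square_eq_if_recurrence:
  fixes y T b c :: "nat \<Rightarrow> real" and w :: real
  assumes c0: "c 0 = 0" and c_Suc: "\<And>k. c (Suc k) \<noteq> 0"
    and y: "\<And>k. k < N \<Longrightarrow> c (Suc k) * y (Suc k) = w * b k * y k + c k * y (k - 1)"
    and T0: "T 0 = (y 0)\<^sup>2"
    and T: "\<And>k. k < N \<Longrightarrow> (c (Suc k))\<^sup>2 * T (Suc k)
             = w\<^sup>2 * b k * (b k * T k + 2 * (\<Sum>i<k. b i * T i)) + (c k)\<^sup>2 * T (k - 1)"
    and "k \<le> N"
  shows "T k = (y k)\<^sup>2"
proof -
  have cross: "c k * y (k - 1) * y k = w * (\<Sum>i<k. b i * (y i)\<^sup>2)" if "k \<le> N" for k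
    using that
  proof (induction k)
    case (Suc k)
    have "c (Suc k) * y k * y (Suc k) = y k * (c (Suc k) * y (Suc k))"
      by (simp only: mult_ac)
    also have "\<dots> = w * (b k * (y k)\<^sup>2) + c k * y (k - 1) * y k"
      using Suc.prems by (simp add: y algebra_simps power2_eq_square)
    finally show ?case using Suc by (simp add: distrib_left)
  qed (simp add: c0)
  show ?thesis
    using \<open>k \<le> N\<close>
  proof (induction k rule: less_induct)
    case (less k)
    show ?case
    proof (cases k)
      case 0
      then show ?thesis by (simp add: T0)
    next
      case (Suc l)
      \<comment> \<open>For l = 0, where \<open>l - 1\<close> is truncated, both sides vanish
        because c 0 = 0.\<close>
      have "(c l)\<^sup>2 * T (l - 1) = (c l * y (l - 1))\<^sup>2"
      proof (cases l)
        case (Suc l')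
        then show ?thesis using less \<open>k = Suc l\<close> by (simp add: power_mult_distrib)
      qed (simp add: c0)
      moreover have "T l = (y l)\<^sup>2" "(\<Sum>i<l. b i * T i) = (\<Sum>i<l. b i * (y i)\<^sup>2)"
        using less Suc by (auto intro!: sum.cong)
      ultimately have "(c (Suc l))\<^sup>2 * T (Suc l)
          = w * b l * (w * b l * (y l)\<^sup>2 + 2 * (w * (\<Sum>i<l. b i * (y i)\<^sup>2))) + (c l * y (l - 1))\<^sup>2"
        using T[of l] less Suc by (simp add: algebra_simps power2_eq_square)
      also have "w * (\<Sum>i<l. b i * (y i)\<^sup>2) = c l * y (l - 1) * y l"
        using cross[of l] less Suc by simp
      also have "w * b l * (w * b l * (y l)\<^sup>2 + 2 * (c l * y (l - 1) * y l)) + (c l * y (l - 1))\<^sup>2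
          = (w * b l * y l + c l * y (l - 1))\<^sup>2"
        by algebra
      also have "\<dots> = (c (Suc l))\<^sup>2 * (y (Suc l))\<^sup>2"
        using y[of l] less Suc by (simp flip: power_mult_distrib)
      finally have "T (Suc l) = (y (Suc l))\<^sup>2"
        by (rule cancel_left) (simp add: c_Suc)
      then show ?thesis by (simp add: Suc)
    qed
  qed
qed

section \<open>The square of d_k(x)\<close>

lemma choose_Suc_mult: "(real i + 1) * real (k choose Suc i) = (real k - real i) * real (k choose i)"
  using gchoose_Suc_mult[of i "real k"] by (simp add: binomial_gbinomial)

lemma choose_recurrence:
  "(real k + 1) * real (Suc k choose i) - real k * real (k - 1 choose i)
     = (2 * real i + 1) * real (k choose i) + real i * real (k choose (i - 1))"
proof -
  have pred: "real k * real (k - 1 choose i) = (real k - real i) * real (k choose i)"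
    using mult_choose_pred[of k i] choose_Suc_mult[of i k] by simp
  show ?thesis
  proof (cases i)
    case 0
    then show ?thesis by (cases k) simp_all
  next
    case (Suc l)
    have "(real k + 1) * (real (k choose l) + real (k choose Suc l)) - (real k - (real l + 1)) * real (k choose Suc l)
       = (2 * real l + 3) * real (k choose Suc l) + (real l + 1) * real (k choose l)"
      using choose_Suc_mult[of l k] by algebra
    then show ?thesis
      unfolding pred by (simp add: Suc add_ac)
  qed
qed

text \<open>
  The bound \<open>M\<close> only pads the sum with zero terms; keeping it independent of \<open>k\<close> lets consecutive sums be
  compared term by term.
\<close>

definition d_sum :: "nat \<Rightarrow> real \<Rightarrow> nat \<Rightarrow> real" where
  "d_sum M x k = (\<Sum>i<M. real (k choose i) * (x gchoose i) * 2 ^ i)"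

lemma d_sum_recurrence:
  assumes "Suc k < M"
  shows "(real k + 1) * d_sum M x (Suc k) = (2 * x + 1) * d_sum M x k + real k * d_sum M x (k - 1)"
proof -
  \<comment> \<open>The lower term of \<open>choose_recurrence\<close> is \<open>H i\<close>. The
    diagonal terms combine to (2 x + 1) - (2 i + 1) = 2 (x - i), which raises x over i to x over i +
    1 and yields \<open>H (Suc i)\<close>.\<close>
  define H where "H i = real i * real (k choose (i - 1)) * (x gchoose i) * 2 ^ i" for i
  have step: "(2 * x + 1) * (real (k choose i) * (x gchoose i) * 2 ^ i)
      + real k * (real (k - 1 choose i) * (x gchoose i) * 2 ^ i)
      - (real k + 1) * (real (Suc k choose i) * (x gchoose i) * 2 ^ i) = H (Suc i) - H i" for i
  proof -
    have "H (Suc i) = 2 * real (k choose i) * ((real i + 1) * (x gchoose Suc i)) * 2 ^ i"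
      by (simp add: H_def)
    then have H: "H (Suc i) = 2 * real (k choose i) * ((x - real i) * (x gchoose i)) * 2 ^ i"
      unfolding gchoose_Suc_mult .
    have "(2 * x + 1) * (real (k choose i) * (x gchoose i) * 2 ^ i)
      + real k * (real (k - 1 choose i) * (x gchoose i) * 2 ^ i)
      - (real k + 1) * (real (Suc k choose i) * (x gchoose i) * 2 ^ i)
      = ((2 * x + 1) * real (k choose i) - ((real k + 1) * real (Suc k choose i) - real k * real (k - 1 choose i)))
        * ((x gchoose i) * 2 ^ i)"
      by (simp only: left_diff_distrib distrib_right mult.assoc diff_diff_eq2)
    also have "\<dots> = H (Suc i) - H i"
      unfolding choose_recurrence H H_def[of i] by (simp add: algebra_simps)
    finally show ?thesis .
  qed
  have "(2 * x + 1) * d_sum M x k + real k * d_sum M x (k - 1) - (real k + 1) * d_sum M x (Suc k)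
      = (\<Sum>i<M. H (Suc i) - H i)"
    unfolding d_sum_def by (simp only: sum_distrib_left step flip: sum_subtractf sum.distrib)
  also have "\<dots> = H M - H 0"
    by (rule sum_lessThan_telescope)
  also have "\<dots> = 0"
    using assms by (simp add: H_def binomial_eq_0)
  finally show ?thesis by simp
qed

text \<open>This verifies the recurrence for \<open>T\<close> in
  \<open>square_eq_if_recurrence\<close> with c k = k, b = 1 and w = 2 x + 1, for the claimed
  expansion of d_k(x)^2.\<close>

lemma d_square_recurrence:
  fixes x :: real
  defines "T \<equiv> \<lambda>M z. \<Sum>j<M. 4 ^ j * central_binom x j * binom_pair z j"
  assumes "Suc k < M"
  shows "(real k + 1)\<^sup>2 * T M (real k + 1)
     = (2 * x + 1)\<^sup>2 * (T M (real k) + 2 * (\<Sum>i<k. T M (real i))) + (real k)\<^sup>2 * T M (real k - 1)"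
proof -
  define g where "g j = 4 ^ j * central_binom x j" for j
  \<comment> \<open>\<open>H j\<close> is the lower term of \<open>binom_pair_difference2\<close>.
    The rest is a multiple of (2 x + 1)^2 - (2 j + 1)^2 = 4 (x - j)(x + j + 1), the factor that
    takes \<open>g j\<close> to \<open>g (Suc j)\<close>; this is where the powers of 4 come
    from.\<close>
  define H where "H j = (2 * real k + 1) * (2 * real j * g j * binom_pair (real k) (j - 1))" for j
  define S where "S j = (\<Sum>i<k. binom_pair (real i) j)" for j
  have step: "(2 * x + 1)\<^sup>2 * (g j * binom_pair (real k) j + 2 * (g j * S j))
      + (real k)\<^sup>2 * (g j * binom_pair (real k - 1) j) - (real k + 1)\<^sup>2 * (g j * binom_pair (real k + 1) j)
      = H (Suc j) - H j" for j
  proof -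
    define b where "b = binom_pair (real k) j"
    \<comment> \<open>The partial sum over i < k has denominator 2 j + 1, so the identity is proved
      after multiplication by it.\<close>
    have S: "(2 * real j + 1) * (b + 2 * S j) = (2 * real k + 1) * b"
      using sum_binom_pair[of j k] unfolding S_def b_def by algebra
    have "(2 * real j + 1) * (2 * (real j + 1) * g (Suc j))
        = 4 ^ j * 4 * ((2 * real j + 1) * (2 * real j + 2) * central_binom x (Suc j))"
      by (simp add: g_def mult_ac)
    also have "\<dots> = 4 * (x - real j) * (x + real j + 1) * g j"
      unfolding central_binom_Suc g_def by (simp only: mult_ac)
    finally have g: "(2 * real j + 1) * (2 * (real j + 1) * g (Suc j)) = 4 * (x - real j) * (x + real j + 1) * g j" .
    have "(2 * real j + 1) * H (Suc j) = (2 * real k + 1) * b * ((2 * real j + 1) * (2 * (real j + 1) * g (Suc j)))"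
      by (simp add: H_def b_def mult_ac)
    then have H: "(2 * real j + 1) * H (Suc j) = (2 * real k + 1) * b * (4 * (x - real j) * (x + real j + 1) * g j)"
      unfolding g .
    have "(2 * real j + 1) * ((2 * x + 1)\<^sup>2 * (g j * (b + 2 * S j)) - (2 * real k + 1) * (2 * real j + 1) * g j * b)
        = (2 * x + 1)\<^sup>2 * g j * ((2 * real j + 1) * (b + 2 * S j)) - (2 * real j + 1)\<^sup>2 * (2 * real k + 1) * g j * b"
      by algebra
    also have "\<dots> = (2 * real j + 1) * H (Suc j)"
      unfolding S H by algebra
    finally have *: "(2 * x + 1)\<^sup>2 * (g j * (b + 2 * S j)) - (2 * real k + 1) * (2 * real j + 1) * g j * b = H (Suc j)"
      by (rule cancel_left) (simp add: add_nonneg_eq_0_iff)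
    have "(2 * x + 1)\<^sup>2 * (g j * b + 2 * (g j * S j))
        + (real k)\<^sup>2 * (g j * binom_pair (real k - 1) j) - (real k + 1)\<^sup>2 * (g j * binom_pair (real k + 1) j)
        = (2 * x + 1)\<^sup>2 * (g j * (b + 2 * S j))
          - g j * ((real k + 1)\<^sup>2 * binom_pair (real k + 1) j - (real k)\<^sup>2 * binom_pair (real k - 1) j)"
      by algebra
    also have "\<dots> = H (Suc j) - H j"
      unfolding binom_pair_difference2 *[symmetric] H_def[of j] b_def by algebra
    finally show ?thesis unfolding b_def .
  qed
  have T: "T M z = (\<Sum>j<M. g j * binom_pair z j)" for z
    by (simp only: T_def g_def)
  have ST: "(\<Sum>i<k. T M (real i)) = (\<Sum>j<M. g j * S j)"
    unfolding T S_def sum_distrib_left by (rule sum.swap)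
  have "(2 * x + 1)\<^sup>2 * (T M (real k) + 2 * (\<Sum>i<k. T M (real i))) + (real k)\<^sup>2 * T M (real k - 1)
      - (real k + 1)\<^sup>2 * T M (real k + 1) = (\<Sum>j<M. H (Suc j) - H j)"
    unfolding ST unfolding T by (simp only: sum_distrib_left step flip: sum_subtractf sum.distrib)
  also have "\<dots> = H M - H 0"
    by (rule sum_lessThan_telescope)
  also have "\<dots> = 0"
    using assms by (simp add: H_def binom_pair_of_nat_eq_0)
  finally show ?thesis by simp
qed

lemma d_sum_square:
  assumes "k < M"
  shows "(d_sum M x k)\<^sup>2 = (\<Sum>j<M. 4 ^ j * central_binom x j * binom_pair (real k) j)"
proof -
  define T where "T k = (\<Sum>j<M. 4 ^ j * central_binom x j * binom_pair (real k) j)" for k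
  have "T k = (d_sum M x k)\<^sup>2"
  \<comment> \<open>The recurrences hold only while \<open>Suc l < M\<close>, since the padded sums
    are cut at \<open>M\<close>; hence the bound M - 1.\<close>
  proof (rule square_eq_if_recurrence[where c = real and b = "\<lambda>_. 1" and w = "2 * x + 1" and N = "M - 1"])
    show "T 0 = (d_sum M x 0)\<^sup>2"
    proof -
      have "T 0 = (\<Sum>j<M. if j = 0 then 1 else 0)"
        unfolding T_def by (intro sum.cong refl) (simp add: binom_pair_of_nat_eq_0[of 0, simplified])
      moreover have "d_sum M x 0 = (\<Sum>j<M. if j = 0 then 1 else 0)"
        unfolding d_sum_def by (intro sum.cong refl) (auto simp: binomial_eq_0)
      ultimately show ?thesis using assms by simp
    qed
    fix l assume "l < M - 1"
    then have l: "Suc l < M" by simp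
    show "real (Suc l) * d_sum M x (Suc l) = (2 * x + 1) * 1 * d_sum M x l + real l * d_sum M x (l - 1)"
      using d_sum_recurrence[OF l] by (simp add: add_ac)
    show "(real (Suc l))\<^sup>2 * T (Suc l)
        = (2 * x + 1)\<^sup>2 * 1 * (1 * T l + 2 * (\<Sum>i<l. 1 * T i)) + (real l)\<^sup>2 * T (l - 1)"
      using d_square_recurrence[OF l, of x] unfolding T_def by (cases l) (simp_all add: add_ac)
  qed (use assms in simp_all)
  then show ?thesis by (simp add: T_def)
qed

section \<open>The square of \<open>s_k(x)\<close>\<close>

definition s_sum :: "nat \<Rightarrow> nat \<Rightarrow> real \<Rightarrow> real" where
  "s_sum M n x = (\<Sum>i<M. real (n choose i) * binom_pair x i)"

text \<open>Dual to the case of d: \<open>binom_pair_difference2\<close> acts on the variable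
  \<open>x\<close>, and (2 n + 1) - (2 i + 1) = 2 (n - i) raises C(n, i) to C(n, i + 1).\<close>

lemma s_sum_recurrence:
  assumes "n < M"
  shows "(x + 1)\<^sup>2 * s_sum M n (x + 1) = (2 * real n + 1) * (2 * x + 1) * s_sum M n x + x\<^sup>2 * s_sum M n (x - 1)"
proof -
  define H where "H i = (2 * x + 1) * (2 * real i * real (n choose i) * binom_pair x (i - 1))" for i
  have step: "(2 * real n + 1) * (2 * x + 1) * (real (n choose i) * binom_pair x i)
      + x\<^sup>2 * (real (n choose i) * binom_pair (x - 1) i) - (x + 1)\<^sup>2 * (real (n choose i) * binom_pair (x + 1) i)
      = H (Suc i) - H i" for i
  proof -
    have "H (Suc i) = (2 * x + 1) * (2 * ((real i + 1) * real (n choose Suc i)) * binom_pair x i)"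
      by (simp add: H_def)
    then have H: "H (Suc i) = (2 * x + 1) * (2 * ((real n - real i) * real (n choose i)) * binom_pair x i)"
      unfolding choose_Suc_mult .
    have "(2 * real n + 1) * (2 * x + 1) * (real (n choose i) * binom_pair x i)
      + x\<^sup>2 * (real (n choose i) * binom_pair (x - 1) i) - (x + 1)\<^sup>2 * (real (n choose i) * binom_pair (x + 1) i)
      = (2 * real n + 1) * (2 * x + 1) * (real (n choose i) * binom_pair x i)
        - real (n choose i) * ((x + 1)\<^sup>2 * binom_pair (x + 1) i - x\<^sup>2 * binom_pair (x - 1) i)"
      by algebra
    also have "\<dots> = H (Suc i) - H i"
      unfolding H H_def[of i] binom_pair_difference2 by algebra
    finally show ?thesis .
  qed
  have "(2 * real n + 1) * (2 * x + 1) * s_sum M n x + x\<^sup>2 * s_sum M n (x - 1) - (x + 1)\<^sup>2 * s_sum M n (x + 1)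
      = (\<Sum>i<M. H (Suc i) - H i)"
    unfolding s_sum_def by (simp only: sum_distrib_left step flip: sum_subtractf sum.distrib)
  also have "\<dots> = H M - H 0"
    by (rule sum_lessThan_telescope)
  also have "\<dots> = 0"
    using assms by (simp add: H_def binomial_eq_0)
  finally show ?thesis by simp
qed

definition s_coeff :: "nat \<Rightarrow> nat \<Rightarrow> real" where
  "s_coeff j r = real ((2 * j choose r) * (r choose j))"

text \<open>The coefficient is the trinomial (2 j)! / ((2 j - r)! j! (r - j)!), extended by
  zero.\<close>

lemma s_coeff_eq_inv_fact:
  "s_coeff j r = fact (2 * j) * inv_fact (2 * int j - int r) * inv_fact (int j) * inv_fact (int r - int j)"
proof -
  have "s_coeff j r = (fact r * inv_fact (int r))
      * (fact (2 * j) * inv_fact (2 * int j - int r) * inv_fact (int j) * inv_fact (int r - int j))"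
    unfolding s_coeff_def of_nat_mult choose_eq_inv_fact by (simp add: mult_ac)
  then show ?thesis by simp
qed

text \<open>The terms with j - 1 stem from (2 n + 1)^2 B(n, j) = (2 j + 1)^2 B(n, j) + 4 (j + 1)^2
  B(n, j + 1), reindexed. Summed against B(n, j), the identity becomes a recurrence in
  \<open>r\<close> alone.\<close>

lemma s_coeff_recurrence:
  "2 * (real r + 1) ^ 3 * s_coeff j (Suc r)
     = (2 * real r + 1) * (((2 * real j + 1)\<^sup>2 - 2 * (real r)\<^sup>2 - 2 * real r - 1) * s_coeff j r
         + 4 * (real j)\<^sup>2 * s_coeff (j - 1) r)
       + 2 * real r * (((2 * real j + 1)\<^sup>2 - (real r)\<^sup>2) * s_coeff j (r - 1)
         + 4 * (real j)\<^sup>2 * s_coeff (j - 1) (r - 1))"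
proof (cases j)
  case 0
  consider "r = 0" | "r = 1" | "1 < r" by linarith
  then show ?thesis
    by cases (simp_all add: 0 s_coeff_def binomial_eq_0)
next
  case j: (Suc J)
  show ?thesis
  proof (cases r)
    case 0
    then show ?thesis
      by (cases J) (simp_all add: j s_coeff_def)
  next
    case r: (Suc R)
    define \<alpha> where "\<alpha> = inv_fact (2 * int J - int R + 2)"
    define \<gamma> where "\<gamma> = inv_fact (int R - int J + 1)"
    define \<iota> where "\<iota> = inv_fact (int J + 1)"
    define F :: real where "F = fact (2 * J)"
    define a where "a = 2 * real J - real R + 2"
    define c where "c = real R - real J + 1"
    have A: "inv_fact (2 * int J - int R + 1) = a * \<alpha>"
      using inv_fact_pred[of "2 * int J - int R + 2"] by (simp add: a_def \<alpha>_def add_ac)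
    have A1: "inv_fact (2 * int J - int R) = (a - 1) * (a * \<alpha>)"
      using inv_fact_pred[of "2 * int J - int R + 1"] A by (simp add: a_def)
    have A2: "inv_fact (2 * int J - int R - 1) = (a - 2) * ((a - 1) * (a * \<alpha>))"
      using inv_fact_pred[of "2 * int J - int R"] A1 by (simp add: a_def)
    have C: "inv_fact (int R - int J) = c * \<gamma>"
      using inv_fact_pred[of "int R - int J + 1"] by (simp add: c_def \<gamma>_def)
    have C1: "inv_fact (int R - int J - 1) = (c - 1) * (c * \<gamma>)"
      using inv_fact_pred[of "int R - int J"] C by (simp add: c_def)
    have I: "inv_fact (int J) = (real J + 1) * \<iota>"
      using inv_fact_pred[of "int J + 1"] by (simp add: \<iota>_def)
    have F: "fact (2 * Suc J) = (2 * real J + 2) * ((2 * real J + 1) * F)"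
      by (simp add: F_def algebra_simps)
    have idx: "2 * int (Suc J) - int (Suc R) = 2 * int J - int R + 1"
      "2 * int (Suc J) - int (Suc (Suc R)) = 2 * int J - int R"
      "2 * int (Suc J) - int R = 2 * int J - int R + 2"
      "2 * int J - int (Suc R) = 2 * int J - int R - 1"
      "int (Suc R) - int (Suc J) = int R - int J"
      "int (Suc (Suc R)) - int (Suc J) = int R - int J + 1"
      "int R - int (Suc J) = int R - int J - 1"
      "int (Suc R) - int J = int R - int J + 1"
      by simp_all
    have I': "inv_fact (int (Suc J)) = \<iota>"
      by (simp add: \<iota>_def add_ac)
    have eqs:
      "s_coeff (Suc J) (Suc R) = (2 * real J + 2) * ((2 * real J + 1) * F) * (a * \<alpha>) * \<iota> * (c * \<gamma>)"
      "s_coeff (Suc J) (Suc (Suc R)) = (2 * real J + 2) * ((2 * real J + 1) * F) * ((a - 1) * (a * \<alpha>)) * \<iota> * \<gamma>"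
      "s_coeff (Suc J) R = (2 * real J + 2) * ((2 * real J + 1) * F) * \<alpha> * \<iota> * ((c - 1) * (c * \<gamma>))"
      "s_coeff J (Suc R) = F * ((a - 2) * ((a - 1) * (a * \<alpha>))) * ((real J + 1) * \<iota>) * \<gamma>"
      "s_coeff J R = F * ((a - 1) * (a * \<alpha>)) * ((real J + 1) * \<iota>) * (c * \<gamma>)"
      by (simp_all only: s_coeff_eq_inv_fact idx F A A1 A2 C C1 I I' flip: F_def \<alpha>_def \<gamma>_def)
    show ?thesis
      unfolding j r diff_Suc_1 eqs of_nat_Suc a_def c_def by algebra
  qed
qed

text \<open>At z = n < N this is the coefficient of B(x, r) in s_n(x)^2; the terms with j > n
  vanish.\<close>

definition s_square_coeff :: "nat \<Rightarrow> real \<Rightarrow> nat \<Rightarrow> real" where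
  "s_square_coeff N z r = (\<Sum>j<N. s_coeff j r * binom_pair z j)"

lemma s_square_coeff_recurrence:
  assumes "n < N"
  defines "A \<equiv> s_square_coeff N (real n)" and "w \<equiv> 2 * real n + 1"
  shows "2 * (real r + 1) ^ 3 * A (Suc r)
     = (2 * real r + 1) * (w\<^sup>2 - 2 * (real r)\<^sup>2 - 2 * real r - 1) * A r
       + 2 * real r * (w\<^sup>2 - (real r)\<^sup>2) * A (r - 1)"
proof -
  define B where "B = binom_pair (real n)"
  define E where "E j = (2 * real r + 1) * s_coeff j r + 2 * real r * s_coeff j (r - 1)" for j
  \<comment> \<open>\<open>H (Suc j)\<close> equals ((2 n + 1)^2 - (2 j + 1)^2) E j B(n, j), so the
    difference trades \<open>w\<close> for 2 j + 1 and brings in the terms with j - 1.\<close>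
  define H where "H j = 4 * (real j)\<^sup>2 * E (j - 1) * B j" for j
  have step: "(2 * real r + 1) * (w\<^sup>2 - 2 * (real r)\<^sup>2 - 2 * real r - 1) * (s_coeff j r * B j)
       + 2 * real r * (w\<^sup>2 - (real r)\<^sup>2) * (s_coeff j (r - 1) * B j)
       - 2 * (real r + 1) ^ 3 * (s_coeff j (Suc r) * B j) = H (Suc j) - H j" for j
  proof -
    have "H (Suc j) = 4 * E j * ((real j + 1)\<^sup>2 * B (Suc j))"
      by (simp add: H_def add_ac)
    then have H: "H (Suc j) = 4 * E j * ((real n - real j) * (real n + real j + 1) * B j)"
      unfolding B_def binom_pair_Suc .
    have "(2 * real r + 1) * (w\<^sup>2 - 2 * (real r)\<^sup>2 - 2 * real r - 1) * (s_coeff j r * B j)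
       + 2 * real r * (w\<^sup>2 - (real r)\<^sup>2) * (s_coeff j (r - 1) * B j)
       - 2 * (real r + 1) ^ 3 * (s_coeff j (Suc r) * B j)
       = ((2 * real r + 1) * (w\<^sup>2 - 2 * (real r)\<^sup>2 - 2 * real r - 1) * s_coeff j r
       + 2 * real r * (w\<^sup>2 - (real r)\<^sup>2) * s_coeff j (r - 1)
       - 2 * (real r + 1) ^ 3 * s_coeff j (Suc r)) * B j"
      by algebra
    also have "\<dots> = H (Suc j) - H j"
      unfolding H H_def[of j] s_coeff_recurrence E_def w_def by algebra
    finally show ?thesis .
  qed
  have "(2 * real r + 1) * (w\<^sup>2 - 2 * (real r)\<^sup>2 - 2 * real r - 1) * A r
       + 2 * real r * (w\<^sup>2 - (real r)\<^sup>2) * A (r - 1) - 2 * (real r + 1) ^ 3 * A (Suc r)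
       = (\<Sum>j<N. H (Suc j) - H j)"
    unfolding A_def s_square_coeff_def B_def[symmetric]
    by (simp only: sum_distrib_left step flip: sum_subtractf sum.distrib)
  also have "\<dots> = H N - H 0"
    by (rule sum_lessThan_telescope)
  also have "\<dots> = 0"
    using assms by (simp add: H_def B_def binom_pair_of_nat_eq_0)
  finally show ?thesis by simp
qed

text \<open>Evaluates the expression b_x T_x + 2 (sum of b_k T_k) of
  \<open>square_eq_if_recurrence\<close> on one basis function for b_k = 2 k + 1, in a form that
  matches \<open>binom_pair_difference4\<close>.\<close>

lemma odd_partial_sum_binom_pair:
  "(2 * real x + 1) * binom_pair (real x) r + 2 * (\<Sum>k<x. (2 * real k + 1) * binom_pair (real k) r)
     = 2 * (real r + 1) * binom_pair (real x) (Suc r) + (2 * real r + 1) * binom_pair (real x) r"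
proof -
  define S where "S = (\<Sum>k<x. (2 * real k + 1) * binom_pair (real k) r)"
  have "(real r + 1) * ((2 * real x + 1) * binom_pair (real x) r + 2 * S)
      = (real r + 1) * (2 * real x + 1) * binom_pair (real x) r + 2 * ((real r + 1) * S)"
    by algebra
  also have "\<dots> = 2 * ((real r + 1)\<^sup>2 * binom_pair (real x) (Suc r))
      + (real r + 1) * (2 * real r + 1) * binom_pair (real x) r"
    unfolding S_def sum_odd_binom_pair binom_pair_Suc by algebra
  also have "\<dots> = (real r + 1) * (2 * (real r + 1) * binom_pair (real x) (Suc r)
      + (2 * real r + 1) * binom_pair (real x) r)"
    by algebra
  finally have "(2 * real x + 1) * binom_pair (real x) r + 2 * S
      = 2 * (real r + 1) * binom_pair (real x) (Suc r) + (2 * real r + 1) * binom_pair (real x) r"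
    by (rule cancel_left) simp
  then show ?thesis unfolding S_def .
qed

lemma s_square_recurrence:
  fixes n N :: nat
  defines "T \<equiv> \<lambda>M z. \<Sum>r<M. s_square_coeff N (real n) r * binom_pair z r"
  assumes "Suc x < M" "n < N"
  shows "(real x + 1) ^ 4 * T M (real x + 1)
     = (2 * real n + 1)\<^sup>2 * (2 * real x + 1)
         * ((2 * real x + 1) * T M (real x) + 2 * (\<Sum>k<x. (2 * real k + 1) * T M (real k)))
       + real x ^ 4 * T M (real x - 1)"
proof -
  define A where "A = s_square_coeff N (real n)"
  define B where "B = binom_pair (real x)"
  define w where "w = 2 * real n + 1"
  define S where "S r = (\<Sum>k<x. (2 * real k + 1) * binom_pair (real k) r)" for r
  define H where "H r = (2 * real x + 1) *
    (2 * real r * (w\<^sup>2 - (real r)\<^sup>2) * A (r - 1) * B r + 2 * real r ^ 3 * A r * B (r - 1))" for r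
  have step: "w\<^sup>2 * (2 * real x + 1) * ((2 * real x + 1) * (A r * B r) + 2 * (A r * S r))
      + real x ^ 4 * (A r * binom_pair (real x - 1) r) - (real x + 1) ^ 4 * (A r * binom_pair (real x + 1) r)
      = H (Suc r) - H r" for r
  proof -
    have "H (Suc r) = (2 * real x + 1) * (2 * (real r + 1) * (w\<^sup>2 - (real r + 1)\<^sup>2) * A r * B (Suc r)
        + (2 * (real r + 1) ^ 3 * A (Suc r)) * B r)"
      by (simp add: H_def add_ac)
    \<comment> \<open>Replacing A (r + 1) by its recurrence leaves only A r and A (r - 1), the
      coefficients in the summand and in \<open>H r\<close>.\<close>
    then have H: "H (Suc r) = (2 * real x + 1) * (2 * (real r + 1) * (w\<^sup>2 - (real r + 1)\<^sup>2) * A r * B (Suc r)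
        + ((2 * real r + 1) * (w\<^sup>2 - 2 * (real r)\<^sup>2 - 2 * real r - 1) * A r
       + 2 * real r * (w\<^sup>2 - (real r)\<^sup>2) * A (r - 1)) * B r)"
      unfolding A_def w_def s_square_coeff_recurrence[OF \<open>n < N\<close>] .
    have "w\<^sup>2 * (2 * real x + 1) * ((2 * real x + 1) * (A r * B r) + 2 * (A r * S r))
      + real x ^ 4 * (A r * binom_pair (real x - 1) r) - (real x + 1) ^ 4 * (A r * binom_pair (real x + 1) r)
      = w\<^sup>2 * (2 * real x + 1) * A r * ((2 * real x + 1) * B r + 2 * S r)
      - A r * ((real x + 1) ^ 4 * binom_pair (real x + 1) r - real x ^ 4 * binom_pair (real x - 1) r)"
      by algebra
    also have "\<dots> = H (Suc r) - H r"
      unfolding H H_def[of r] binom_pair_difference4 B_def S_def odd_partial_sum_binom_pair by algebra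
    finally show ?thesis .
  qed
  have T: "T M z = (\<Sum>r<M. A r * binom_pair z r)" for z
    by (simp only: T_def A_def)
  have ST: "(\<Sum>k<x. (2 * real k + 1) * T M (real k)) = (\<Sum>r<M. A r * S r)"
    unfolding T S_def sum_distrib_left by (subst sum.swap) (simp only: mult_ac)
  have "w\<^sup>2 * (2 * real x + 1) * ((2 * real x + 1) * T M (real x) + 2 * (\<Sum>k<x. (2 * real k + 1) * T M (real k)))
      + real x ^ 4 * T M (real x - 1) - (real x + 1) ^ 4 * T M (real x + 1) = (\<Sum>r<M. H (Suc r) - H r)"
    unfolding ST unfolding T B_def[symmetric]
    by (simp only: sum_distrib_left step flip: sum_subtractf sum.distrib)
  also have "\<dots> = H M - H 0"
    by (rule sum_lessThan_telescope)
  also have "\<dots> = 0"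
    using assms by (simp add: H_def B_def binom_pair_of_nat_eq_0)
  finally show ?thesis by (simp add: w_def)
qed

lemma s_sum_square:
  assumes "n < N" "x < M"
  shows "(s_sum N n (real x))\<^sup>2 = (\<Sum>r<M. s_square_coeff N (real n) r * binom_pair (real x) r)"
proof -
  define T where "T x = (\<Sum>r<M. s_square_coeff N (real n) r * binom_pair (real x) r)" for x
  have "T x = (s_sum N n (real x))\<^sup>2"
  \<comment> \<open>The running index is now the variable x, with n fixed, so the expansion is
    obtained at natural x only.\<close>
  proof (rule square_eq_if_recurrence[where c = "\<lambda>x. (real x)\<^sup>2" and b = "\<lambda>x. 2 * real x + 1"
          and w = "2 * real n + 1" and N = "M - 1"])
    show "T 0 = (s_sum N n (real 0))\<^sup>2"
    proof -
      have "T 0 = (\<Sum>r<M. if r = 0 then s_square_coeff N (real n) 0 else 0)"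
        unfolding T_def by (intro sum.cong refl) (simp add: binom_pair_of_nat_eq_0[of 0, simplified])
      moreover have "s_square_coeff N (real n) 0 = (\<Sum>j<N. if j = 0 then 1 else 0)"
        unfolding s_square_coeff_def s_coeff_def by (intro sum.cong refl) (auto simp: binomial_eq_0)
      moreover have "s_sum N n 0 = (\<Sum>j<N. if j = 0 then 1 else 0)"
        unfolding s_sum_def by (intro sum.cong refl) (simp add: binom_pair_of_nat_eq_0[of 0, simplified])
      ultimately show ?thesis using assms by simp
    qed
    fix l assume "l < M - 1"
    then have l: "Suc l < M" by simp
    show "(real (Suc l))\<^sup>2 * s_sum N n (real (Suc l)) = (2 * real n + 1) * (2 * real l + 1) * s_sum N n (real l)
        + (real l)\<^sup>2 * s_sum N n (real (l - 1))"
      using s_sum_recurrence[OF \<open>n < N\<close>, of "real l"] by (cases l) (simp_all add: add_ac)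
    show "((real (Suc l))\<^sup>2)\<^sup>2 * T (Suc l) = (2 * real n + 1)\<^sup>2 * (2 * real l + 1) *
        ((2 * real l + 1) * T l + 2 * (\<Sum>i<l. (2 * real i + 1) * T i)) + ((real l)\<^sup>2)\<^sup>2 * T (l - 1)"
      using s_square_recurrence[OF l \<open>n < N\<close>] unfolding T_def by (cases l) (simp_all add: add_ac)
  qed (use assms in simp_all)
  then show ?thesis by (simp add: T_def)
qed

section \<open>Integrality\<close>

text \<open>C(2 j, r) C(r, j) = C(2 j, j) C(j, r - j), and C(2 j, j) is j + 1 times the Catalan
  number C(2 j, j) - C(2 j, j + 1).\<close>

lemma s_coeff_eq_Suc_mult_int: "\<exists>e\<in>\<int>. s_coeff j r = (real j + 1) * e"
proof (cases "j \<le> r \<and> r \<le> 2 * j")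
  case True
  then have "s_coeff j r = real (2 * j choose j) * real (j choose (r - j))"
    using choose_mult[of j r "2 * j"] by (simp add: s_coeff_def mult_2 flip: of_nat_mult)
  moreover have "real (2 * j choose j) = (real j + 1) * (real (2 * j choose j) - real (2 * j choose Suc j))"
    using choose_Suc_mult[of j "2 * j"] by (simp add: algebra_simps)
  ultimately have "s_coeff j r
      = (real j + 1) * ((real (2 * j choose j) - real (2 * j choose Suc j)) * real (j choose (r - j)))"
    by simp
  then show ?thesis by (meson Ints_diff Ints_mult Ints_of_nat)
next
  case False
  then have "s_coeff j r = (real j + 1) * 0" by (auto simp: s_coeff_def binomial_eq_0)
  then show ?thesis by (meson Ints_0)
qed

section \<open>From the polynomials to the sums\<close>

lemma poly_d_poly:
  assumes "k < M"
  shows "poly (d_poly k) x = d_sum M x k"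
proof -
  have "poly (d_poly k) x = (\<Sum>i=0..k. real (k choose i) * (x gchoose i) * 2 ^ i)"
    by (simp add: d_poly_def poly_sum poly_binom_poly)
  also have "\<dots> = d_sum M x k"
    unfolding d_sum_def by (rule sum.mono_neutral_left) (use assms in \<open>auto simp: binomial_eq_0\<close>)
  finally show ?thesis .
qed

lemma poly_s_poly:
  assumes "k < M"
  shows "poly (s_poly k) x = s_sum M k x"
proof -
  have "poly (s_poly k) x = (\<Sum>i=0..k. real (k choose i) * binom_pair x i)"
    by (simp add: s_poly_def poly_sum poly_binom_poly binom_pair_def mult.assoc)
  also have "\<dots> = s_sum M k x"
    unfolding s_sum_def by (rule sum.mono_neutral_left) (use assms in \<open>auto simp: binomial_eq_0\<close>)
  finally show ?thesis .
qed

lemma d_poly_square: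
  assumes "k < n"
  shows "(poly (d_poly k) x)\<^sup>2 = (\<Sum>j<n. 4 ^ j * central_binom x j * binom_pair (real k) j)"
  using assms by (simp add: poly_d_poly d_sum_square)

lemma s_poly_reflect: "poly (s_poly k) (- 1 - x) = poly (s_poly k) x"
  unfolding poly_s_poly[OF lessI] s_sum_def binom_pair_reflect ..

text \<open>Reflection moves x to a natural number y, where \<open>s_sum_square\<close> applies.
  Collecting the sum over r into \<open>e j\<close> keeps the coefficients independent of k.\<close>

lemma s_poly_square:
  obtains e where "\<And>j. e j \<in> \<int>"
    and "\<And>k. k < n \<Longrightarrow> (poly (s_poly k) (of_int x))\<^sup>2 = (\<Sum>j<n. (real j + 1) * e j * binom_pair (real k) j)"
proof -
  obtain y where y: "poly (s_poly k) (of_int x) = poly (s_poly k) (real y)" for k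
  proof (cases x rule: int_cases_reflect)
    case (1 y)
    then show thesis using that[of y] by simp
  next
    case (2 y)
    then show thesis using that[of y] s_poly_reflect[of _ "real y"] by simp
  qed
  obtain e' where e': "\<And>j r. e' j r \<in> \<int>" "\<And>j r. s_coeff j r = (real j + 1) * e' j r"
    using s_coeff_eq_Suc_mult_int by metis
  define e where "e j = (\<Sum>r<Suc y. e' j r * binom_pair (real y) r)" for j
  have "e j \<in> \<int>" for j
    unfolding e_def using binom_pair_Ints[of "int y"] by (intro Ints_sum Ints_mult e') simp
  moreover have "(poly (s_poly k) (of_int x))\<^sup>2 = (\<Sum>j<n. (real j + 1) * e j * binom_pair (real k) j)"
    if "k < n" for k
  proof -
    have "(poly (s_poly k) (of_int x))\<^sup>2
        = (\<Sum>r<Suc y. \<Sum>j<n. (real j + 1) * e' j r * binom_pair (real k) j * binom_pair (real y) r)"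
      unfolding y poly_s_poly[OF that] s_sum_square[OF that lessI]
      by (simp only: s_square_coeff_def e' sum_distrib_right)
    also have "\<dots> = (\<Sum>j<n. \<Sum>r<Suc y. (real j + 1) * e' j r * binom_pair (real k) j * binom_pair (real y) r)"
      by (rule sum.swap)
    also have "\<dots> = (\<Sum>j<n. (real j + 1) * e j * binom_pair (real k) j)"
      unfolding e_def sum_distrib_left sum_distrib_right by (simp only: mult_ac)
    finally show ?thesis .
  qed
  ultimately show thesis by (rule that)
qed

text \<open>Shared by d and s. Agreement of \<open>f\<close> with the squares is assumed for k < n
  only, because the expansions are cut at n.\<close>

lemma poly_sum_power_Ints:
  fixes p :: "nat \<Rightarrow> real poly"
  assumes "n > 0" and sq: "\<And>k. k < n \<Longrightarrow> (poly (p k) x)\<^sup>2 = f k" and f: "f \<in> binom_span"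
  shows "poly (smult (1 / real n) (\<Sum>k=0..n-1. of_nat (2 * k + 1) * p k ^ (2 * m))) x \<in> \<int>"
    and "poly (smult (1 / real n) (\<Sum>k=0..n-1. (-1) ^ k * of_nat (2 * k + 1) * p k ^ (2 * m))) x \<in> \<int>"
proof -
  have range: "{0..n-1} = {..<n}" using \<open>n > 0\<close> by auto
  have sqm: "poly (p k) x ^ (2 * m) = f k ^ m" if "k < n" for k
    by (simp add: power_mult sq[OF that])
  obtain z where z: "z \<in> \<int>" "(\<Sum>k<n. (2 * real k + 1) * f k ^ m) = real n * z"
    using sum_odd_binom_span[OF binom_span_power[OF f]] by blast
  have "poly (smult (1 / real n) (\<Sum>k=0..n-1. of_nat (2 * k + 1) * p k ^ (2 * m))) x
      = 1 / real n * (\<Sum>k<n. (2 * real k + 1) * f k ^ m)"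
    unfolding range by (simp add: poly_sum sqm add_ac)
  then show "poly (smult (1 / real n) (\<Sum>k=0..n-1. of_nat (2 * k + 1) * p k ^ (2 * m))) x \<in> \<int>"
    using z \<open>n > 0\<close> by simp
  obtain z where z: "z \<in> \<int>" "(\<Sum>k<n. (- 1) ^ k * (2 * real k + 1) * f k ^ m) = real n * z"
    using sum_alternating_odd_binom_span[OF binom_span_power[OF f]] by blast
  have "poly (smult (1 / real n) (\<Sum>k=0..n-1. (-1) ^ k * of_nat (2 * k + 1) * p k ^ (2 * m))) x
      = 1 / real n * (\<Sum>k<n. (- 1) ^ k * (2 * real k + 1) * f k ^ m)"
    unfolding range by (simp add: poly_sum sqm add_ac)
  then show "poly (smult (1 / real n) (\<Sum>k=0..n-1. (-1) ^ k * of_nat (2 * k + 1) * p k ^ (2 * m))) x \<in> \<int>"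
    using z \<open>n > 0\<close> by simp
qed

lemma poly_sum_d_poly_square_Ints:
  assumes "n > 0"
  shows "poly (smult (1 / (2 * real n ^ 2))
           ([:0, 1:] * ([:0, 1:] + 1) * (\<Sum>k=0..n-1. of_nat (2 * k + 1) * d_poly k ^ 2))) (of_int x) \<in> \<int>"
proof -
  define q where "q = central_binom (of_int x)"
  \<comment> \<open>From x(x + 1) = j(j + 1) + (x - j)(x + j + 1): the second part turns C(x + j, 2
    j) into (2 j + 1)(2 j + 2) C(x + j + 1, 2 j + 2), so both parts contain j + 1.\<close>
  define e where "e j = 4 ^ j * (real j * q j) + 2 * (4 ^ j * ((2 * real j + 1) * q (Suc j)))" for j
  \<comment> \<open>This accounts for the 2 in the denominator: the first term of \<open>e j\<close>
    is zero for j = 0 and otherwise even through 4^j, and the second has an explicit factor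
    2.\<close>
  have e_half: "e j / 2 \<in> \<int>" for j
  proof -
    have q: "q j \<in> \<int>" for j
      unfolding q_def by (rule central_binom_Ints)
    have "4 ^ j * (real j * q j) / 2 \<in> \<int>"
    proof (cases j)
      case (Suc i)
      then have "4 ^ j * (real j * q j) / 2 = 2 * 4 ^ i * (real j * q j)" by simp
      also have "\<dots> \<in> \<int>" by (intro Ints_mult Ints_power q) simp_all
      finally show ?thesis .
    qed simp
    moreover have "4 ^ j * ((2 * real j + 1) * q (Suc j)) \<in> \<int>"
      using q by simp
    moreover have "e j / 2 = 4 ^ j * (real j * q j) / 2 + 4 ^ j * ((2 * real j + 1) * q (Suc j))"
      by (simp add: e_def add_divide_distrib)
    ultimately show ?thesis by (metis Ints_add)
  qed
  have e: "of_int x * (of_int x + 1) * (4 ^ j * q j) = (real j + 1) * e j" for j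
  proof -
    have "(real j + 1) * e j = 4 ^ j * ((real j + 1) * real j * q j + (2 * real j + 1) * (2 * real j + 2) * q (Suc j))"
      by (simp add: e_def algebra_simps)
    also have "\<dots> = of_int x * (of_int x + 1) * (4 ^ j * q j)"
      unfolding q_def central_binom_Suc by (simp add: algebra_simps)
    finally show ?thesis by simp
  qed
  have "(\<Sum>k<n. (2 * real k + 1) * (of_int x * (of_int x + 1) * (poly (d_poly k) (of_int x))\<^sup>2))
      = (real n)\<^sup>2 * (\<Sum>j<n. e j * real ((n - 1 choose j) * (n + j choose j)))"
  proof (rule sum_odd_binom_pair_combination)
    fix k assume "k < n"
    show "of_int x * (of_int x + 1) * (poly (d_poly k) (of_int x))\<^sup>2
        = (\<Sum>j<n. (real j + 1) * e j * binom_pair (real k) j)"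
      unfolding d_poly_square[OF \<open>k < n\<close>] q_def[symmetric] e[symmetric] by (simp only: sum_distrib_left mult.assoc)
  qed
  moreover have "{0..n-1} = {..<n}" using assms by auto
  ultimately have "poly (smult (1 / (2 * real n ^ 2))
      ([:0, 1:] * ([:0, 1:] + 1) * (\<Sum>k=0..n-1. of_nat (2 * k + 1) * d_poly k ^ 2))) (of_int x)
      = 1 / (2 * (real n)\<^sup>2) * ((real n)\<^sup>2 * (\<Sum>j<n. e j * real ((n - 1 choose j) * (n + j choose j))))"
    by (simp add: poly_sum sum_distrib_left mult_ac add_ac)
  also have "\<dots> = (\<Sum>j<n. e j / 2 * real ((n - 1 choose j) * (n + j choose j)))"
    using assms by (simp add: sum_divide_distrib)
  also have "\<dots> \<in> \<int>"
    by (intro Ints_sum Ints_mult e_half Ints_of_nat)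
  finally show ?thesis .
qed

lemma poly_sum_s_poly_square_Ints:
  assumes "n > 0"
  shows "poly (smult (1 / real n ^ 2) (\<Sum>k=0..n-1. of_nat (2 * k + 1) * s_poly k ^ 2)) (of_int x) \<in> \<int>"
proof -
  obtain e where e: "\<And>j. e j \<in> \<int>"
    and sq: "\<And>k. k < n \<Longrightarrow> (poly (s_poly k) (of_int x))\<^sup>2 = (\<Sum>j<n. (real j + 1) * e j * binom_pair (real k) j)"
    using s_poly_square[where n = n and x = x] by blast
  have "{0..n-1} = {..<n}" using assms by auto
  then have "poly (smult (1 / real n ^ 2) (\<Sum>k=0..n-1. of_nat (2 * k + 1) * s_poly k ^ 2)) (of_int x)
      = 1 / (real n)\<^sup>2 * (\<Sum>k<n. (2 * real k + 1) * (poly (s_poly k) (of_int x))\<^sup>2)"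
    by (simp add: poly_sum add_ac)
  also have "\<dots> = (\<Sum>j<n. e j * real ((n - 1 choose j) * (n + j choose j)))"
    using sum_odd_binom_pair_combination[OF sq] assms by simp
  also have "\<dots> \<in> \<int>"
    by (intro Ints_sum Ints_mult e Ints_of_nat)
  finally show ?thesis .
qed

theorem theorem1p1:
  fixes m n :: nat
  assumes "m > 0" and "n > 0"
  shows "integer_valued (smult (1 / (2 * real n ^ 2))
           ([:0, 1:] * ([:0, 1:] + 1) * (\<Sum>k=0..n-1. of_nat (2 * k + 1) * d_poly k ^ 2)))
    \<and> integer_valued (smult (1 / real n)
           (\<Sum>k=0..n-1. of_nat (2 * k + 1) * d_poly k ^ (2 * m)))
    \<and> integer_valued (smult (1 / real n)
           (\<Sum>k=0..n-1. (-1) ^ k * of_nat (2 * k + 1) * d_poly k ^ (2 * m)))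
    \<and> integer_valued (smult (1 / real n ^ 2)
           (\<Sum>k=0..n-1. of_nat (2 * k + 1) * s_poly k ^ 2))
    \<and> integer_valued (smult (1 / real n)
           (\<Sum>k=0..n-1. of_nat (2 * k + 1) * s_poly k ^ (2 * m)))
    \<and> integer_valued (smult (1 / real n)
           (\<Sum>k=0..n-1. (-1) ^ k * of_nat (2 * k + 1) * s_poly k ^ (2 * m)))"
proof -
  have d: "(\<lambda>k. \<Sum>j<n. 4 ^ j * central_binom (of_int x) j * binom_pair (real k) j) \<in> binom_span" for x
    by (intro binom_span_sum binom_span_Ints binom_span.gen Ints_mult Ints_power central_binom_Ints) simp
  have s: "poly (smult (1 / real n) (\<Sum>k=0..n-1. of_nat (2 * k + 1) * s_poly k ^ (2 * m))) (of_int x) \<in> \<int>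
    \<and> poly (smult (1 / real n) (\<Sum>k=0..n-1. (-1) ^ k * of_nat (2 * k + 1) * s_poly k ^ (2 * m))) (of_int x) \<in> \<int>"
    for x
  proof -
    obtain e where e: "\<And>j. e j \<in> \<int>"
      and sq: "\<And>k. k < n \<Longrightarrow> (poly (s_poly k) (of_int x))\<^sup>2 = (\<Sum>j<n. (real j + 1) * e j * binom_pair (real k) j)"
      using s_poly_square[where n = n and x = x] by blast
    have "(\<lambda>k. \<Sum>j<n. (real j + 1) * e j * binom_pair (real k) j) \<in> binom_span"
      by (intro binom_span_sum binom_span_Ints binom_span.gen Ints_mult e) simp
    from poly_sum_power_Ints[OF \<open>n > 0\<close> sq this] show ?thesis ..
  qed
  show ?thesis
    unfolding integer_valued_def
    by (intro conjI allI poly_sum_d_poly_square_Ints poly_sum_s_poly_square_Ints \<open>n > 0\<close>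
          poly_sum_power_Ints[OF \<open>n > 0\<close> d_poly_square d] s[THEN conjunct1] s[THEN conjunct2])
qed

end
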